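(* Let $k,\ell$ be non-negative integers and let $a\in\mathbb{C}\setminus\mathbb{Z}$. Denote $$\Upsilon_{p,q}^{a,k,\ell}(x):=\frac{2^{p+q}\,(-k)_p\,(-\ell)_q\,(a)_{p+q}}{(-2k)_p\,(-2\ell)_q\,p!\,q!}\,\sin^p x\,\cos^q x .$$ Then $$\frac{\left(\frac{a+1}{2}\right)_\ell}{\left(\frac12\right)_\ell}\;{}_2F_1\!\left(\tfrac{a}{2},\,-\tfrac{a}{2}-k-\ell;\;\tfrac12-k;\;\sin^2x\right)=\sum_{p=0}^{k}\sum_{q=0}^{\ell}\Upsilon_{p,q}^{a,k,\ell}(x)\,\cos\!\left(ax+(p+q)x-\tfrac{\pi}{2}p\right)$$ and $$\frac{\left(\frac{a+1}{2}\right)_k\left(\frac{a}{2}\right)_{k+\ell+1}\,\sin^{2k+1}x}{\left(\frac12\right)_k\left(\frac12\right)_{k+1}\left(\frac12\right)_\ell}\;{}_2F_1\!\left(\tfrac{a+1}{2}+k,\,\tfrac{1-a}{2}-\ell;\;\tfrac32+k;\;\sin^2x\right)=\sum_{p=0}^{k}\sum_{q=0}^{\ell}\Upsilon_{p,q}^{a,k,\ell}(x)\,\sin\!\left(ax+(p+q)x-\tfrac{\pi}{2}p\right).$$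
   Context: $(a)_n=a(a+1)\cdots(a+n-1)$ is the Pochhammer symbol, with $(a)_0=1$. ${}_2F_1(A,B;C;z)=\sum_{n\ge0}\frac{(A)_n(B)_n}{(C)_n\,n!}z^n$ is the Gauss hypergeometric function. For $0\le p\le k$ and $0\le q\le \ell$ the denominators $(-2k)_p$ and $(-2\ell)_q$ are nonzero. The identities are between analytic functions of $x$ near $x=0$ (in particular they hold for real $x$ with $|x|<\pi/2$). *)

theory Defs
  imports "HOL-Analysis.Analysis"
begin

text \<open>
  The power series of the Gauss hypergeometric function. For \<open>C\<close> not a non-positive integer it
  converges whenever \<open>norm z < 1\<close>; the value carries no meaning where the series diverges.
\<close>

definition gauss_2F1 :: "complex \<Rightarrow> complex \<Rightarrow> complex \<Rightarrow> complex \<Rightarrow> complex" where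
  "gauss_2F1 A B C z =
     (\<Sum>n. pochhammer A n * pochhammer B n / (pochhammer C n * fact n) * z ^ n)"

lemma gauss_2F1_eq_eval_fps: "gauss_2F1 A B C z = eval_fps (fps_hypergeo [A, B] [C] 1) z"
  by (simp add: gauss_2F1_def eval_fps_def)

definition Upsilon :: "complex \<Rightarrow> nat \<Rightarrow> nat \<Rightarrow> nat \<Rightarrow> nat \<Rightarrow> complex \<Rightarrow> complex" where
  "Upsilon a k l p q x =
     2 ^ (p + q) * pochhammer (- of_nat k) p * pochhammer (- of_nat l) q * pochhammer a (p + q)
       / (pochhammer (- 2 * of_nat k) p * pochhammer (- 2 * of_nat l) q * fact p * fact q)
       * sin x ^ p * cos x ^ q"

end

theory Submission
  imports Defs "HOL-Complex_Analysis.Complex_Analysis"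
begin

text \<open>
  Put \<open>c\<^sub>k(p) = 2\<^sup>p (-k)\<^sub>p / ((-2k)\<^sub>p p!)\<close>, the coefficients of \<open>\<^sub>1F\<^sub>1(-k; -2k; 2t)\<close>.
  Everything rests on one terminating Gauss sum,
  \<open>\<Sum>q c\<^sub>l(q) (b)\<^sub>q = ((b+1)/2)\<^sub>l / (1/2)\<^sub>l\<close> (\<open>sum_bessel_coeff_pochhammer\<close>), used twice.

  Replace cosine and sine in the double sums by \<open>exp (\<epsilon> y)\<close> with \<open>\<epsilon> = \<plusminus>i\<close>. Because
  \<open>exp (-\<epsilon> x) / cos x = 1 - \<epsilon> tan x\<close>, the binomial series expands
  \<open>(cos x)\<^sup>c exp (\<epsilon> c x)\<close> in powers of \<open>\<epsilon> tan x\<close>. After multiplication by \<open>(cos x)\<^sup>a\<close>, every term of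
  the double sum is of this kind, with \<open>c = a + p + q\<close> and an extra factor \<open>(-\<epsilon> tan x)\<^sup>p\<close>.
  Collecting the coefficient of \<open>(\<epsilon> tan x)\<^sup>m\<close> makes the sums over \<open>p\<close> and \<open>q\<close> independent: they
  become the Gauss sum at \<open>b = -m\<close> and at \<open>b = a + m\<close>. So that coefficient is
  \[ \frac{((1-m)/2)_k}{(1/2)_k} \cdot \frac{((a+m+1)/2)_l}{(1/2)_l} \cdot \frac{(a)_m}{m!} \]
  (\<open>Upsilon_sum_exp_tan_series\<close>).

  Taking the even and odd parts in \<open>\<epsilon>\<close> returns cosine and sine and selects even and odd \<open>m\<close>. For
  odd \<open>m < 2k + 1\<close> the first factor vanishes, which is why the sine identity starts at the power
  \<open>2k + 1\<close>. Rewritten in Pochhammer symbols, both parts are multiples of \<open>\<^sub>2F\<^sub>1\<close> at \<open>- tan\<^sup>2 x\<close>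
  (by a constant and by a multiple of \<open>tan\<^sup>2\<^sup>k\<^sup>+\<^sup>1 x\<close>), and
  Pfaff's transformation (\<open>pfaff_transformation\<close>) turns the argument into \<open>sin\<^sup>2 x\<close> while absorbing
  the factor \<open>(cos x)\<^sup>a\<close>.

  The series are manipulated for small real \<open>x\<close>. Both sides are holomorphic in \<open>t = sin x\<close> on
  the unit disc, where \<open>x = Arcsin t\<close>, so the identity theorem extends the result to the whole region
  (\<open>eq_Upsilon_sum_of_real_eq\<close>).
\<close>

section \<open>A terminating Gauss sum\<close>

text \<open>
  Up to normalisation \<open>\<Sum>p. bessel_coeff k p * t ^ p\<close> is the reverse Bessel polynomial of degree
  \<open>k\<close>; here its constant term is 1.
\<close>

definition bessel_coeff :: "nat \<Rightarrow> nat \<Rightarrow> complex" where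
  "bessel_coeff k p =
     2 ^ p * pochhammer (- of_nat k) p / (pochhammer (- 2 * of_nat k) p * fact p)"

lemma pochhammer_minus_of_nat_add:
  "pochhammer (- of_nat (q + d)) q = ((- 1) ^ q * fact (q + d) / fact d :: complex)"
proof -
  have "pochhammer (- of_nat (q + d)) q = (- 1) ^ q * pochhammer (1 + of_nat d :: complex) q"
    by (subst pochhammer_minus) (simp add: add_ac)
  moreover have "fact (d + q) = (fact d * pochhammer (1 + of_nat d) q :: complex)"
    unfolding pochhammer_fact by (rule pochhammer_product')
  ultimately show ?thesis by (simp add: add_ac)
qed

text \<open>
  Writing the degree as \<open>q + d\<close> avoids truncated subtraction inside the factorials.
\<close>

lemma bessel_coeff_eq_fact:
  "bessel_coeff (q + d) q =
     2 ^ q * fact (q + d) * fact (q + 2 * d) / (fact d * fact (2 * q + 2 * d) * fact q)"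
proof -
  have "- 2 * of_nat (q + d) = - (of_nat (q + (q + 2 * d)) :: complex)"
    by simp
  then have "pochhammer (- 2 * of_nat (q + d)) q = ((- 1) ^ q * fact (q + (q + 2 * d)) / fact (q + 2 * d) :: complex)"
    using pochhammer_minus_of_nat_add[of q "q + 2 * d"] by (simp only:)
  moreover have "q + (q + 2 * d) = 2 * q + 2 * d"
    by simp
  ultimately have "pochhammer (- 2 * of_nat (q + d)) q =
      ((- 1) ^ q * fact (2 * q + 2 * d) / fact (q + 2 * d) :: complex)"
    by (simp only:)
  then have "bessel_coeff (q + d) q = 2 ^ q * ((- 1) ^ q * fact (q + d) / fact d) /
      ((- 1) ^ q * fact (2 * q + 2 * d) / fact (q + 2 * d) * fact q)"
    unfolding bessel_coeff_def pochhammer_minus_of_nat_add by (simp only:)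
  then show ?thesis by (simp add: mult_ac)
qed

text \<open>
  This is \<open>\<^sub>2F\<^sub>1(-l, b; -2l; 2)\<close> in closed form. The proof is by creative telescoping: the closed form
  predicts that \<open>(2l + 1)\<close> times the sum for \<open>l + 1\<close> equals \<open>(b + 1 + 2l)\<close> times the sum for \<open>l\<close>, and
  the termwise difference of the two sides is \<open>G (Suc q) - G q\<close> for an explicit certificate \<open>G\<close>.
\<close>

lemma sum_bessel_coeff_pochhammer:
  "(\<Sum>q=0..l. bessel_coeff l q * pochhammer b q) = pochhammer ((b + 1) / 2) l / pochhammer (1 / 2) l"
proof (induction l)
  case 0
  then show ?case by (simp add: bessel_coeff_def)
next
  case (Suc l)
  \<comment> \<open>Writing \<open>q / q!\<close> rather than \<open>1 / (q - 1)!\<close> gives \<open>G 0 = 0\<close> without a case distinction.\<close>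
  define G :: "nat \<Rightarrow> complex" where
    "G q = - (of_nat q * 2 ^ q * fact l * fact (2 * l + 1 - q) * pochhammer b q) /
              (2 * fact (l + 1 - q) * fact (2 * l) * fact q)" for q
  let ?t = "\<lambda>l q. bessel_coeff l q * pochhammer b q"
  have step: "(2 * of_nat l + 1) * ?t (Suc l) q - (b + 1 + 2 * of_nat l) * ?t l q = G (Suc q) - G q"
    if "q \<le> l" for q
  proof -
    from that obtain d where l: "l = q + d" using le_Suc_ex by blast
    define Q D F H E U V P :: complex
      where "Q = of_nat q" and "D = of_nat d" and "F = fact (q + d)" and "H = fact (q + 2 * d)"
        and "E = fact d" and "U = fact q" and "V = fact (2 * q + 2 * d)" and "P = pochhammer b q"
    have nz: "F \<noteq> 0" "H \<noteq> 0" "E \<noteq> 0" "U \<noteq> 0" "V \<noteq> 0" "D + 1 \<noteq> 0" "Q + 1 \<noteq> 0" "2 * Q + 2 * D + 1 \<noteq> 0" "Q + D + 1 \<noteq> 0"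
      unfolding F_def H_def E_def U_def V_def D_def Q_def
      using of_nat_neq_0[of d, where ?'a = complex] of_nat_neq_0[of q, where ?'a = complex]
         of_nat_neq_0[of "q + d", where ?'a = complex] of_nat_neq_0[of "2 * q + 2 * d", where ?'a = complex]
      by (simp_all add: add_ac)
    have fE: "fact (Suc d) = (D + 1) * E"
      by (simp add: E_def D_def)
    have fF: "fact (q + Suc d) = (Q + D + 1) * F"
      by (simp add: F_def D_def Q_def)
    have fH: "fact (q + 2 * Suc d) = (Q + 2 * D + 2) * ((Q + 2 * D + 1) * H)"
      by (simp add: H_def D_def Q_def add_ac)
    have fV: "fact (2 * q + 2 * Suc d) = (2 * Q + 2 * D + 2) * ((2 * Q + 2 * D + 1) * V)"
      by (simp add: V_def D_def Q_def add_ac)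
    have t: "?t l q = 2 ^ q * F * H / (E * V * U) * P"
      unfolding l bessel_coeff_eq_fact F_def H_def E_def V_def U_def P_def ..
    have "?t (Suc l) q = 2 ^ q * fact (q + Suc d) * fact (q + 2 * Suc d) /
        (fact (Suc d) * fact (2 * q + 2 * Suc d) * fact q) * pochhammer b q"
      using bessel_coeff_eq_fact[of q "Suc d"] by (simp add: l)
    also have "\<dots> = 2 ^ q * ((Q + D + 1) * F) * ((Q + 2 * D + 2) * ((Q + 2 * D + 1) * H)) /
        ((D + 1) * E * ((2 * Q + 2 * D + 2) * ((2 * Q + 2 * D + 1) * V)) * U) * P"
      unfolding fE fF fH fV by (simp only: U_def P_def)
    finally have t': "?t (Suc l) q = \<dots>" .
    have Gq: "G q = - (Q * 2 ^ q * F * ((Q + 2 * D + 1) * H) * P) / (2 * ((D + 1) * E) * V * U)"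
    proof -
      have "2 * l + 1 - q = Suc (q + 2 * d)" "l + 1 - q = Suc d" "2 * l = 2 * q + 2 * d" by (simp_all add: l)
      moreover have "fact (Suc (q + 2 * d)) = (Q + 2 * D + 1) * H"
        by (simp add: H_def Q_def D_def add_ac)
      ultimately show ?thesis
        by (simp only: G_def l[symmetric] fE) (simp add: l F_def V_def U_def P_def Q_def mult_ac)
    qed
    have GSq: "G (Suc q) = - ((Q + 1) * (2 * 2 ^ q) * F * H * (P * (b + Q))) / (2 * E * V * ((Q + 1) * U))"
    proof -
      have "2 * l + 1 - Suc q = q + 2 * d" "l + 1 - Suc q = d" "2 * l = 2 * q + 2 * d" by (simp_all add: l)
      moreover have "fact (Suc q) = (Q + 1) * U" "of_nat (Suc q) = Q + 1"
          "pochhammer b (Suc q) = P * (b + Q)"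
        by (simp_all add: U_def Q_def P_def pochhammer_Suc)
      ultimately show ?thesis
        by (simp only: G_def power_Suc) (simp add: l F_def H_def E_def V_def mult_ac)
    qed
    \<comment> \<open>All four terms are multiples of the summand \<open>K\<close> for \<open>l\<close>, by factors rational in \<open>b\<close>, \<open>q\<close>, \<open>d\<close>.\<close>
    define K where "K = 2 ^ q * F * H * P / (E * V * U)"
    have e1: "?t l q = K" unfolding t K_def by simp
    have e2: "(2 * of_nat l + 1) * ?t (Suc l) q = (Q + 2 * D + 2) * (Q + 2 * D + 1) / (2 * (D + 1)) * K"
    proof -
      \<comment> \<open>Linear factors are named so that fractions cancel them as atoms, without expanding sums.\<close>
      define W Y Z where "W = D + 1" and "Y = 2 * Q + 2 * D + 1" and "Z = Q + D + 1"
      have "2 * of_nat l + 1 = Y" "2 * Q + 2 * D + 2 = 2 * Z" by (simp_all add: l Q_def D_def Y_def Z_def)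
      then show ?thesis using nz unfolding t' K_def W_def[symmetric] Y_def[symmetric] Z_def[symmetric]
        by (simp add: divide_simps)
    qed
    have e3: "G q = - (Q * (Q + 2 * D + 1) / (2 * (D + 1))) * K"
    proof -
      define W where "W = D + 1"
      show ?thesis using nz unfolding Gq K_def W_def[symmetric] by (simp add: divide_simps)
    qed
    have e4: "G (Suc q) = - (b + Q) * K"
    proof -
      define X where "X = b + Q"
      show ?thesis using nz unfolding GSq K_def X_def[symmetric] by (simp add: divide_simps)
    qed
    have e5: "(Q + 2 * D + 2) * (Q + 2 * D + 1) / (2 * (D + 1)) - (b + 1 + 2 * (Q + D)) =
        - (b + Q) - - (Q * (Q + 2 * D + 1) / (2 * (D + 1)))"
    proof -
      define W M where "W = D + 1" and "M = Q + 2 * D + 1"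
      have 1: "(Q + 2 * W) * M / (2 * W) = Q * M / (2 * W) + M"
        using nz by (simp add: distrib_right add_divide_distrib W_def[symmetric])
      have 2: "Q + 2 * D + 2 = Q + 2 * W" "b + 1 + 2 * (Q + D) = b + Q + M" by (simp_all add: W_def M_def)
      show ?thesis unfolding W_def[symmetric] M_def[symmetric] 2 1 by simp
    qed
    have e6: "of_nat l = Q + D" by (simp add: l Q_def D_def)
    show ?thesis unfolding e2 e1 e3 e4 unfolding e6 left_diff_distrib[symmetric] e5 ..
  qed
  have odd_nz: "2 * of_nat l + 1 \<noteq> (0 :: complex)"
    using of_nat_neq_0[of "2 * l", where ?'a = complex] by (simp add: add.commute)
  \<comment> \<open>The sum for \<open>l + 1\<close> has one more term, which cancels the upper end of the telescoping sum.\<close>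
  have last: "(2 * of_nat l + 1) * ?t (Suc l) (Suc l) = - G (Suc l)"
  proof -
    define L Y F V P :: complex
      where "L = of_nat (Suc l)" and "Y = 2 * of_nat l + 1" and "F = fact l" and "V = fact (2 * l)"
        and "P = pochhammer b (Suc l)"
    have nz: "L \<noteq> 0" "Y \<noteq> 0" "F \<noteq> 0" "V \<noteq> 0"
      using odd_nz by (simp_all add: L_def Y_def F_def V_def del: of_nat_Suc)
    have "?t (Suc l) (Suc l) = 2 ^ Suc l * fact (Suc l) * fact (Suc l) / (fact (2 * Suc l) * fact (Suc l)) * P"
      using bessel_coeff_eq_fact[of "Suc l" 0] by (simp add: P_def)
    also have "fact (Suc l) = L * F" by (simp add: L_def F_def)
    also have "fact (2 * Suc l) = 2 * L * (Y * V)" by (simp add: L_def Y_def V_def algebra_simps)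
    finally have t: "?t (Suc l) (Suc l) = 2 ^ Suc l * (L * F) * (L * F) / (2 * L * (Y * V) * (L * F)) * P" .
    have "2 * l + 1 - Suc l = l" "l + 1 - Suc l = 0" by simp_all
    then have "G (Suc l) = - (L * 2 ^ Suc l * F * F * P) / (2 * V * (L * F))"
      by (simp add: G_def L_def F_def P_def V_def)
    then show ?thesis unfolding t Y_def[symmetric] using nz by (simp add: divide_simps)
  qed
  have "(2 * of_nat l + 1) * (\<Sum>q=0..Suc l. ?t (Suc l) q) - (b + 1 + 2 * of_nat l) * (\<Sum>q=0..l. ?t l q)
      = (\<Sum>q=0..l. (2 * of_nat l + 1) * ?t (Suc l) q - (b + 1 + 2 * of_nat l) * ?t l q)
         + (2 * of_nat l + 1) * ?t (Suc l) (Suc l)"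
    unfolding sum_subtractf sum_distrib_left[symmetric] by (simp add: distrib_left del: of_nat_Suc)
  also have "\<dots> = (\<Sum>q=0..l. G (Suc q) - G q) - G (Suc l)"
  proof -
    have "(\<Sum>q=0..l. (2 * of_nat l + 1) * ?t (Suc l) q - (b + 1 + 2 * of_nat l) * ?t l q) = (\<Sum>q=0..l. G (Suc q) - G q)"
      by (rule sum.cong[OF refl], rule step, simp)
    then show ?thesis unfolding last by simp
  qed
  also have "(\<Sum>q=0..l. G (Suc q) - G q) = G (Suc l)"
  proof -
    have "G 0 = 0" by (simp add: G_def)
    then show ?thesis by (subst sum_Suc_diff) simp_all
  qed
  finally have eq: "(2 * of_nat l + 1) * (\<Sum>q=0..Suc l. ?t (Suc l) q) = (b + 1 + 2 * of_nat l) * (\<Sum>q=0..l. ?t l q)"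
    by simp
  have cancel: "Y * S = R * T \<Longrightarrow> Y \<noteq> 0 \<Longrightarrow> S = R / Y * T" for Y S R T :: complex
    by (simp add: nonzero_eq_divide_eq mult.commute)
  have rec: "(\<Sum>q=0..Suc l. ?t (Suc l) q) =
      (b + 1 + 2 * of_nat l) / (2 * of_nat l + 1) * (\<Sum>q=0..l. ?t l q)"
    using cancel[OF eq odd_nz] .
  have ratio: "(b + 1 + 2 * of_nat l) / (2 * of_nat l + 1) = ((b + 1) / 2 + of_nat l) / (1 / 2 + of_nat l)"
  proof -
    have 1: "(b + 1) / 2 + of_nat l = (b + 1 + 2 * of_nat l) / 2"
      by (simp add: add_divide_distrib)
    have 2: "1 / 2 + of_nat l = (2 * of_nat l + 1 :: complex) / 2"
      by (simp add: add_divide_distrib)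
    have half: "X / Y = X / 2 / (Y / 2)" for X Y :: complex by simp
    show ?thesis unfolding 1 2 by (rule half)
  qed
  show ?case
    unfolding rec Suc.IH ratio pochhammer_rec' times_divide_times_eq ..
qed

section \<open>Pochhammer symbols at half-integers\<close>

lemma pochhammer_half_nonzero: "pochhammer (1 / 2 :: complex) n \<noteq> 0"
proof
  assume "pochhammer (1 / 2 :: complex) n = 0"
  then obtain i where "1 / 2 = - (of_nat i :: complex)"
    by (auto simp: pochhammer_eq_0_iff)
  then have "Re (1 / 2) = Re (- of_nat i)" by (rule arg_cong)
  then show False by simp
qed

text \<open>
  The product \<open>(1/2 - r)\<^sub>r\<^sub>+\<^sub>k\<close> can be split after \<open>k\<close> or after \<open>r\<close> factors; reversing the order and the
  signs of the two blocks of length \<open>r\<close> gives the claim. It moves \<open>r\<close> from the base to the index, as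
  needed to read off a hypergeometric term in \<open>r\<close>.
\<close>

lemma pochhammer_half_integer_reflection:
  "pochhammer (1 / 2 - of_nat r) k * pochhammer (1 / 2 - of_nat k) r =
     (pochhammer (1 / 2) k * pochhammer (1 / 2) r :: complex)"
proof -
  have refl: "pochhammer (1 / 2 - c) r = (- 1) ^ r * pochhammer (1 / 2 + c - of_nat r) r" for c :: complex
    using pochhammer_minus[of "c - 1 / 2" r] by (simp add: algebra_simps)
  have "pochhammer (1 / 2 - of_nat r) k * pochhammer (1 / 2 - of_nat r + of_nat k) r =
      pochhammer (1 / 2 - of_nat r) r * (pochhammer (1 / 2 - of_nat r + of_nat r) k :: complex)"
    using pochhammer_product'[of "1 / 2 - of_nat r :: complex" k r]
      pochhammer_product'[of "1 / 2 - of_nat r :: complex" r k] by (simp only: add.commute)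
  moreover have "pochhammer (1 / 2 - of_nat k) r = (- 1) ^ r * (pochhammer (1 / 2 - of_nat r + of_nat k) r :: complex)"
    using refl[of "of_nat k"] by (simp add: algebra_simps)
  moreover have "pochhammer (1 / 2) r = (- 1) ^ r * (pochhammer (1 / 2 - of_nat r) r :: complex)"
    using refl[of 0] by simp
  ultimately show ?thesis by (simp add: mult_ac)
qed

lemma pochhammer_double_halves:
  "pochhammer (a :: complex) (2 * n) = 4 ^ n * pochhammer (a / 2) n * pochhammer ((a + 1) / 2) n"
  using pochhammer_double[of "a / 2" n] by (simp add: power_mult add_divide_distrib)

lemma pochhammer_double_Suc:
  "pochhammer (a :: complex) (2 * n + 1) = 2 * 4 ^ n * pochhammer ((a + 1) / 2) n * pochhammer (a / 2) (n + 1)"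
proof -
  have "pochhammer (a + 1) (2 * n) = 4 ^ n * pochhammer ((a + 1) / 2) n * pochhammer (a / 2 + 1) n"
    using pochhammer_double_halves[of "a + 1" n] by (simp add: add_divide_distrib add_ac)
  then have "pochhammer a (2 * n + 1) = a * (4 ^ n * pochhammer ((a + 1) / 2) n * pochhammer (a / 2 + 1) n)"
    by (simp add: pochhammer_rec)
  also have "\<dots> = 2 * 4 ^ n * pochhammer ((a + 1) / 2) n * (a / 2 * pochhammer (a / 2 + 1) n)"
    by simp
  also have "a / 2 * pochhammer (a / 2 + 1) n = pochhammer (a / 2) (n + 1)"
    by (simp add: pochhammer_rec)
  finally show ?thesis .
qed

section \<open>The hypergeometric series and the transformation of Pfaff\<close>

lemma tendsto_shifted_of_nat_ratio:
  fixes a b :: complex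
  shows "(\<lambda>n. (a + of_nat n) / (b + of_nat n)) \<longlonglongrightarrow> 1"
proof -
  have inf: "filterlim (\<lambda>n. b + of_nat n) at_infinity sequentially"
    by (intro tendsto_add_filterlim_at_infinity[OF tendsto_const] tendsto_of_nat)
  then have "(\<lambda>n. 1 + (a - b) / (b + of_nat n)) \<longlonglongrightarrow> 1 + 0"
    by (intro tendsto_intros tendsto_divide_0[OF tendsto_const])
  moreover have "eventually (\<lambda>n. b + of_nat n \<noteq> 0) sequentially"
    using filterlim_at_infinity_imp_eventually_ne[OF inf, of 0] by simp
  then have "eventually (\<lambda>n. 1 + (a - b) / (b + of_nat n) = (a + of_nat n) / (b + of_nat n)) sequentially"
    by eventually_elim (simp add: field_simps)
  ultimately show ?thesis
    by (simp add: tendsto_cong)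
qed

text \<open>
  The ratio of consecutive terms tends to \<open>z\<close>. The ratio test is used in its multiplicative form
  \<open>norm (f (Suc n)) \<le> c * norm (f n)\<close>, so terminating series are covered as well.
\<close>

lemma summable_norm_gauss_2F1:
  fixes z :: complex
  assumes "norm z < 1"
  shows "summable (\<lambda>n. norm (pochhammer A n * pochhammer B n / (pochhammer C n * fact n) * z ^ n))"
proof -
  let ?f = "\<lambda>n. pochhammer A n * pochhammer B n / (pochhammer C n * fact n) * z ^ n"
  let ?r = "\<lambda>n. (A + of_nat n) / (C + of_nat n) * ((B + of_nat n) / (1 + of_nat n)) * z"
  have "?r \<longlonglongrightarrow> 1 * 1 * z"
    by (intro tendsto_intros tendsto_shifted_of_nat_ratio)
  then have "(\<lambda>n. norm (?r n)) \<longlonglongrightarrow> norm z"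
    using tendsto_norm by fastforce
  moreover obtain c where c: "norm z < c" "c < 1"
    using assms dense by blast
  ultimately have "eventually (\<lambda>n. norm (?r n) < c) sequentially"
    by (simp only: order_tendstoD(2))
  then obtain N where N: "\<And>n. n \<ge> N \<Longrightarrow> norm (?r n) < c"
    by (auto simp: eventually_sequentially)
  have step: "?f (Suc n) = ?r n * ?f n" for n
    unfolding pochhammer_rec' fact_Suc power_Suc of_nat_Suc by (simp add: field_simps)
  have "summable (\<lambda>n. norm (?f n))"
  proof (rule summable_ratio_test[OF c(2)])
    show "norm (norm (?f (Suc n))) \<le> c * norm (norm (?f n))" if "n \<ge> N" for n
    proof -
      have "norm (?f (Suc n)) = norm (?r n) * norm (?f n)"
        unfolding step by (rule norm_mult)
      also have "\<dots> \<le> c * norm (?f n)"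
        using N[OF that] by (intro mult_right_mono) auto
      finally show ?thesis by simp
    qed
  qed
  then show ?thesis .
qed

lemma gauss_2F1_sums:
  assumes "norm z < 1"
  shows "(\<lambda>n. pochhammer A n * pochhammer B n / (pochhammer C n * fact n) * z ^ n) sums gauss_2F1 A B C z"
  unfolding gauss_2F1_def
  using summable_norm_cancel[OF summable_norm_gauss_2F1[OF assms]] by (rule summable_sums)

lemma holomorphic_on_gauss_2F1:
  "gauss_2F1 A B C holomorphic_on ball 0 1"
proof -
  have "conv_radius (\<lambda>n. fps_nth (fps_hypergeo [A, B] [C] 1) n) \<ge> 1"
  proof (rule conv_radius_geI_ex')
    fix r :: real
    assume "0 < r" "ereal r < 1"
    then have "norm (of_real r :: complex) < 1"
      by simp
    from summable_norm_cancel[OF summable_norm_gauss_2F1[OF this]]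
    show "summable (\<lambda>n. fps_nth (fps_hypergeo [A, B] [C] 1) n * of_real r ^ n)"
      by simp
  qed
  then have "ball 0 1 \<subseteq> eball 0 (fps_conv_radius (fps_hypergeo [A, B] [C] 1))"
    unfolding fps_conv_radius_def
    by (intro ball_eball_mono) (simp add: one_ereal_def)
  moreover have "gauss_2F1 A B C = eval_fps (fps_hypergeo [A, B] [C] 1)"
    by (rule ext) (rule gauss_2F1_eq_eval_fps)
  ultimately show ?thesis
    using holomorphic_on_eval_fps by metis
qed

lemma holomorphic_on_gauss_2F1_squared:
  "(\<lambda>t. gauss_2F1 A B C (t\<^sup>2)) holomorphic_on ball 0 1"
proof -
  have "(\<lambda>t :: complex. t\<^sup>2) ` ball 0 1 \<subseteq> ball 0 1"
    by (auto simp: norm_power power_less_one_iff)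
  moreover have "(\<lambda>t :: complex. t\<^sup>2) holomorphic_on ball 0 1"
    by (intro holomorphic_intros)
  ultimately show ?thesis
    using holomorphic_on_compose_gen[OF _ holomorphic_on_gauss_2F1] by (force simp: o_def)
qed

lemma binomial_series_pochhammer:
  fixes z c :: complex
  assumes "norm z < 1"
  shows "(\<lambda>j. pochhammer c j / fact j * z ^ j) sums ((1 - z) powr (- c))"
proof -
  have "(- c gchoose j) * (- z) ^ j = pochhammer c j / fact j * z ^ j" for j
    by (simp add: gbinomial_pochhammer flip: power_mult_distrib)
  with gen_binomial_complex[of "- z" "- c"] assms show ?thesis
    by simp
qed

lemma binomial_series_pochhammer_real:
  fixes z c :: real
  assumes "norm z < 1"
  shows "(\<lambda>j. pochhammer c j / fact j * z ^ j) sums ((1 - z) powr (- c))"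
proof -
  have "(- c gchoose j) * (- z) ^ j = pochhammer c j / fact j * z ^ j" for j
    by (simp add: gbinomial_pochhammer flip: power_mult_distrib)
  with gen_binomial_real[of "- z" "- c"] assms show ?thesis
    by simp
qed

lemma norm_pochhammer_le: "norm (pochhammer c j) \<le> pochhammer (norm c) j" for c :: complex
proof (induction j)
  case (Suc j)
  have "norm (pochhammer c j) * norm (c + of_nat j) \<le> pochhammer (norm c) j * (norm c + of_nat j)"
    using Suc order_trans[OF norm_ge_zero Suc] norm_triangle_ineq[of c "of_nat j"]
    by (intro mult_mono) auto
  then show ?case by (simp add: pochhammer_Suc norm_mult)
qed simp

text \<open>
  Rearrangement of an absolutely convergent double series along its antidiagonals, with the absolute
  convergence given in the form in which it is checked: rows of norms with a summable sequence of sums.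
\<close>

lemma triangular_sums:
  fixes w :: "nat \<Rightarrow> nat \<Rightarrow> complex"
  assumes rows: "\<And>m. (\<lambda>j. w m j) sums s m" and row_norms: "\<And>m. (\<lambda>j. norm (w m j)) sums N m"
    and "summable N"
  shows "(\<lambda>n. \<Sum>m\<le>n. w m (n - m)) sums (\<Sum>m. s m)"
proof -
  have N_nonneg: "N m \<ge> 0" for m
    using sums_le[OF _ sums_zero row_norms[of m]] by simp
  have norm_rows: "((\<lambda>j. norm (w m j)) has_sum N m) UNIV" for m
    using row_norms by (intro sums_nonneg_imp_has_sum) auto
  have "(\<lambda>(m, j). norm (w m j)) summable_on UNIV \<times> UNIV"
    using norm_rows \<open>summable N\<close> N_nonneg
    by (intro summable_on_SigmaI[where g = N]) (auto intro!: norm_summable_imp_summable_on)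
  then have "(\<lambda>x. norm (case x of (m, j) \<Rightarrow> w m j)) summable_on UNIV \<times> UNIV"
    by (simp add: case_prod_unfold)
  then have summable: "(\<lambda>(m, j). w m j) summable_on UNIV \<times> UNIV"
    by (rule abs_summable_summable)
  have s_le: "norm (s m) \<le> N m" for m
  proof -
    have "norm (suminf (w m)) \<le> (\<Sum>j. norm (w m j))"
      using row_norms[of m] by (intro summable_norm) (simp add: sums_iff)
    then show ?thesis using rows[of m] row_norms[of m] by (simp add: sums_iff)
  qed
  then have s_summable: "summable (\<lambda>m. norm (s m))"
    by (intro summable_comparison_test'[OF \<open>summable N\<close>]) auto
  then have "(s has_sum (\<Sum>m. s m)) UNIV"
    by (intro norm_summable_imp_has_sum summable_sums) (auto intro: summable_norm_cancel)
  moreover have "(w m has_sum s m) UNIV" for m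
    using row_norms[of m] rows[of m] by (intro norm_summable_imp_has_sum) (auto simp: sums_iff)
  ultimately have "((\<lambda>(m, j). w m j) has_sum (\<Sum>m. s m)) (UNIV \<times> UNIV)"
    using summable by (intro has_sum_SigmaI[where g = s]) auto
  moreover have "bij_betw (\<lambda>(n, m). (m, n - m)) (SIGMA n:UNIV. {..n}) (UNIV \<times> UNIV :: (nat \<times> nat) set)"
    by (rule bij_betwI[where g = "\<lambda>(m, j). (m + j, m)"]) auto
  ultimately have "((\<lambda>(n, m). w m (n - m)) has_sum (\<Sum>m. s m)) (SIGMA n:UNIV. {..n})"
    using has_sum_reindex_bij_betw[of "\<lambda>(n, m). (m, n - m)" "SIGMA n:UNIV. {..n}" "UNIV \<times> UNIV" "\<lambda>(m, j). w m j"]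
    by (simp add: case_prod_unfold)
  then have "((\<lambda>n. \<Sum>m\<le>n. w m (n - m)) has_sum (\<Sum>m. s m)) UNIV"
    by (rule has_sum_SigmaD) (auto intro: has_sum_finiteI)
  then show ?thesis
    by (rule has_sum_imp_sums)
qed

text \<open>
  The factor \<open>(A)\<^sub>m (A + m)\<^sub>n\<^sub>-\<^sub>m = (A)\<^sub>n\<close> does not depend on \<open>m\<close>; what remains is the Chu-Vandermonde sum with
  upper parameters \<open>C - B\<close> and \<open>-n\<close>.
\<close>

lemma sum_pfaff_coefficients:
  fixes A B C :: complex
  assumes C: "\<And>i :: nat. C \<noteq> - of_nat i"
  shows "(\<Sum>m\<le>n. pochhammer A m * pochhammer (C - B) m / (pochhammer C m * fact m) * (- 1) ^ m
            * (pochhammer (A + of_nat m) (n - m) / fact (n - m)))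
       = pochhammer A n * pochhammer B n / (pochhammer C n * fact n)"
proof -
  have "pochhammer A m * pochhammer (C - B) m / (pochhammer C m * fact m) * (- 1) ^ m
            * (pochhammer (A + of_nat m) (n - m) / fact (n - m))
        = pochhammer A n / fact n * (pochhammer (C - B) m * pochhammer (- of_nat n) m / (of_nat (fact m) * pochhammer C m))"
    if "m \<le> n" for m
  proof -
    from that obtain j where n: "n = m + j" using le_Suc_ex by blast
    have "pochhammer (- of_nat n) m = ((- 1) ^ m * fact n / fact j :: complex)"
      unfolding n by (rule pochhammer_minus_of_nat_add)
    moreover have "pochhammer A n = pochhammer A m * pochhammer (A + of_nat m) (n - m)"
      using that by (rule pochhammer_product)
    moreover have "n - m = j" by (simp add: n)
    ultimately show ?thesis by (simp add: mult_ac)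
  qed
  then have "(\<Sum>m\<le>n. pochhammer A m * pochhammer (C - B) m / (pochhammer C m * fact m) * (- 1) ^ m
            * (pochhammer (A + of_nat m) (n - m) / fact (n - m)))
     = pochhammer A n / fact n * (\<Sum>m=0..n. pochhammer (C - B) m * pochhammer (- of_nat n) m / (of_nat (fact m) * pochhammer C m))"
    by (simp add: sum_distrib_left atMost_atLeast0)
  also have "(\<Sum>m=0..n. pochhammer (C - B) m * pochhammer (- of_nat n) m / (of_nat (fact m) * pochhammer C m))
      = pochhammer (C - (C - B)) n / pochhammer C n"
    using C by (intro Vandermonde_pochhammer) auto
  finally show ?thesis by (simp add: mult.commute)
qed

text \<open>
  On the left, \<open>(z / (z - 1))\<^sup>m (1 - z)\<^sup>-\<^sup>A = (-z)\<^sup>m (1 - z)\<^sup>-\<^sup>A\<^sup>-\<^sup>m\<close>. Expanding each of these by the binomial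
  series and rearranging by powers of \<open>z\<close> leaves the coefficients computed above. The bound
  \<open>norm z < 1 / 2\<close> is what makes the double series absolutely convergent: its norms are dominated by
  those of a hypergeometric series at \<open>norm z / (1 - norm z)\<close>, which must be less than 1.
\<close>

lemma pfaff_transformation:
  fixes A B C z :: complex
  assumes C: "\<And>i :: nat. C \<noteq> - of_nat i" and z: "norm z < 1 / 2"
  shows "(1 - z) powr (- A) * gauss_2F1 A (C - B) C (z / (z - 1)) = gauss_2F1 A B C z"
proof -
  define u where "u m = pochhammer A m * pochhammer (C - B) m / (pochhammer C m * fact m)" for m
  define w where "w m j = u m * (- z) ^ m * (pochhammer (A + of_nat m) j / fact j * z ^ j)" for m j
  define r where "r = norm z / (1 - norm z)"
  have z1: "norm z < 1" "z \<noteq> 1" "1 - z \<noteq> 0" using z by auto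
  have "r < 1" "0 \<le> r"
    using z by (auto simp: r_def field_simps)
  have z': "norm (z / (z - 1)) < 1"
  proof -
    have "norm (z - 1) \<ge> 1 - norm z" by (metis norm_minus_commute norm_one norm_triangle_ineq2)
    then have "norm (z / (z - 1)) \<le> r" 
      using z by (auto simp: r_def norm_divide intro!: divide_left_mono mult_pos_pos)
    with \<open>r < 1\<close> show ?thesis by simp
  qed
  define s where "s m = (1 - z) powr (- A) * (u m * (z / (z - 1)) ^ m)" for m
  have rows: "w m sums s m" for m
  proof -
    have "w m sums (u m * (- z) ^ m * (1 - z) powr (- (A + of_nat m)))"
      unfolding w_def by (intro sums_mult binomial_series_pochhammer z1)
    also have "(1 - z) powr (- (A + of_nat m)) = (1 - z) powr (- A) / (1 - z) ^ m"
      using z1 by (simp add: powr_diff powr_nat)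
    also have "u m * (- z) ^ m * \<dots> = s m"
    proof -
      have "(- z) ^ m / (1 - z) ^ m = (z / (z - 1)) ^ m"
        by (metis minus_diff_eq minus_divide_divide power_divide)
      then have "(1 - z) powr (- A) * ((- z) ^ m / (1 - z) ^ m) = (1 - z) powr (- A) * (z / (z - 1)) ^ m"
        by (rule arg_cong)
      then have "u m * ((- z) ^ m * ((1 - z) powr (- A) / (1 - z) ^ m)) = u m * ((1 - z) powr (- A) * (z / (z - 1)) ^ m)"
        by (simp only: times_divide_eq_right times_divide_eq_left mult.commute)
      then show ?thesis by (simp only: s_def mult_ac)
    qed
    finally show ?thesis .
  qed
  have norms_summable: "summable (\<lambda>j. norm (w m j))"
    and norms_le: "(\<Sum>j. norm (w m j)) \<le> (1 - norm z) powr (- norm A) * (norm (u m) * r ^ m)" for m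
  proof -
    let ?g = "\<lambda>j. norm (u m) * norm z ^ m * (pochhammer (norm A + of_nat m) j / fact j * norm z ^ j)"
    have "?g sums (norm (u m) * norm z ^ m * (1 - norm z) powr (- (norm A + of_nat m)))"
      using z1 by (intro sums_mult binomial_series_pochhammer_real) auto
    also have "(1 - norm z) powr (- (norm A + of_nat m)) = (1 - norm z) powr (- norm A) / (1 - norm z) ^ m"
      using z1 by (simp add: powr_diff powr_realpow)
    also have "norm (u m) * norm z ^ m * \<dots> = (1 - norm z) powr (- norm A) * (norm (u m) * r ^ m)"
      by (simp add: r_def power_divide)
    finally have g: "?g sums \<dots>" .
    have le: "norm (w m j) \<le> ?g j" for j
    proof -
      have "norm (pochhammer (A + of_nat m) j) \<le> pochhammer (norm (A + of_nat m)) j"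
        by (rule norm_pochhammer_le)
      also have "\<dots> \<le> pochhammer (norm A + of_nat m) j"
        unfolding pochhammer_prod using norm_triangle_ineq[of A "of_nat m"]
        by (intro prod_mono) auto
      finally show ?thesis
        unfolding w_def by (auto simp: norm_mult norm_divide norm_power intro!: mult_left_mono mult_right_mono divide_right_mono)
    qed
    show s: "summable (\<lambda>j. norm (w m j))"
      using le by (intro summable_comparison_test'[OF sums_summable[OF g]]) auto
    show "(\<Sum>j. norm (w m j)) \<le> (1 - norm z) powr (- norm A) * (norm (u m) * r ^ m)"
      using suminf_le[OF le s sums_summable[OF g]] g by (simp add: sums_iff)
  qed
  have "summable (\<lambda>m. norm (u m * of_real r ^ m))"
    unfolding u_def using \<open>r < 1\<close> \<open>0 \<le> r\<close> by (intro summable_norm_gauss_2F1) simp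
  then have "summable (\<lambda>m. (1 - norm z) powr (- norm A) * (norm (u m) * r ^ m))"
    using \<open>0 \<le> r\<close> by (intro summable_mult) (simp add: norm_mult norm_power)
  then have "summable (\<lambda>m. \<Sum>j. norm (w m j))"
  proof (rule summable_comparison_test')
    show "norm (\<Sum>j. norm (w m j)) \<le> (1 - norm z) powr (- norm A) * (norm (u m) * r ^ m)" for m
      using norms_le[of m] suminf_nonneg[OF norms_summable[of m]] by simp
  qed
  then have "(\<lambda>n. \<Sum>m\<le>n. w m (n - m)) sums (\<Sum>m. s m)"
    using rows norms_summable by (intro triangular_sums) (auto intro: summable_sums)
  moreover have "(\<Sum>m\<le>n. w m (n - m)) = pochhammer A n * pochhammer B n / (pochhammer C n * fact n) * z ^ n" for n
  proof -
    have "w m (n - m) = u m * (- 1) ^ m * (pochhammer (A + of_nat m) (n - m) / fact (n - m)) * z ^ n" if "m \<le> n" for m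
    proof -
      have "z ^ n = z ^ m * z ^ (n - m)" using that by (simp flip: power_add)
      then show ?thesis unfolding w_def power_minus[of z] by (simp add: mult_ac)
    qed
    then have "(\<Sum>m\<le>n. w m (n - m)) = (\<Sum>m\<le>n. u m * (- 1) ^ m * (pochhammer (A + of_nat m) (n - m) / fact (n - m))) * z ^ n"
      by (simp add: sum_distrib_right)
    then show ?thesis unfolding u_def sum_pfaff_coefficients[OF C] .
  qed
  moreover have "(\<Sum>m. s m) = (1 - z) powr (- A) * gauss_2F1 A (C - B) C (z / (z - 1))"
    using sums_mult[OF gauss_2F1_sums[OF z']] unfolding s_def u_def by (simp add: sums_iff)
  ultimately show ?thesis
    using gauss_2F1_sums[OF z1(1), of A B C] by (simp add: sums_iff)
qed

text \<open>
  Pfaff's transformation at \<open>z = sin\<^sup>2 x\<close>, where \<open>z / (z - 1) = - tan\<^sup>2 x\<close> and \<open>1 - z = cos\<^sup>2 x\<close>. Complex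
  powers of \<open>cos x\<close> are written with \<open>exp\<close> and the real logarithm, so that exponents add up.
\<close>

lemma gauss_2F1_tan_squared:
  fixes x :: real
  assumes C: "\<And>i :: nat. C \<noteq> - of_nat i" and x: "\<bar>x\<bar> < pi / 2" and s: "(sin x)\<^sup>2 < 1 / 2"
  shows "gauss_2F1 A (C - B) C (- (of_real (tan x))\<^sup>2)
       = exp (2 * A * of_real (ln (cos x))) * gauss_2F1 A B C ((of_real (sin x))\<^sup>2)"
proof -
  have cos: "cos x > 0"
    using x by (intro cos_gt_zero_pi) auto
  define z where "z = complex_of_real ((sin x)\<^sup>2)"
  have one_minus: "1 - z = of_real ((cos x)\<^sup>2)"
    by (simp add: z_def cos_squared_eq)
  have "norm z < 1 / 2"
    using s unfolding z_def norm_of_real by simp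
  moreover have "z / (z - 1) = - (of_real (tan x))\<^sup>2"
  proof -
    have "z / (z - 1) = - (z / (1 - z))"
      by (metis minus_diff_eq minus_divide_right)
    then show ?thesis unfolding one_minus
      by (simp add: z_def tan_def power_divide)
  qed
  moreover have "(1 - z) powr (- A) = exp (- (2 * A * of_real (ln (cos x))))"
    unfolding one_minus powr_def using cos by (simp add: Ln_of_real ln_realpow mult_ac del: of_real_power)
  ultimately have "exp (- (2 * A * of_real (ln (cos x)))) * gauss_2F1 A (C - B) C (- (of_real (tan x))\<^sup>2)
      = gauss_2F1 A B C z"
    using pfaff_transformation[OF C] by metis
  then show ?thesis
    unfolding z_def by (simp add: exp_minus field_simps)
qed

section \<open>Expansion of the double sums in powers of the tangent\<close>

text \<open>
  The function \<open>f\<close> is cosine or sine in the end, but the expansion is carried out for the exponentials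
  \<open>exp (\<epsilon> y)\<close>, for which the angle splits multiplicatively.
\<close>

definition Upsilon_sum :: "(complex \<Rightarrow> complex) \<Rightarrow> complex \<Rightarrow> nat \<Rightarrow> nat \<Rightarrow> complex \<Rightarrow> complex" where
  "Upsilon_sum f a k l x = (\<Sum>p=0..k. \<Sum>q=0..l. Upsilon a k l p q x
     * f (a * x + of_nat (p + q) * x - of_real pi / 2 * of_nat p))"

lemma Upsilon_eq_bessel_coeff:
  "Upsilon a k l p q x =
     bessel_coeff k p * bessel_coeff l q * pochhammer a (p + q) * sin x ^ p * cos x ^ q"
  by (simp add: Upsilon_def bessel_coeff_def power_add mult_ac)

lemma Upsilon_sum_cos_eq:
  "Upsilon_sum cos a k l x =
    (Upsilon_sum (\<lambda>y. exp (\<i> * y)) a k l x + Upsilon_sum (\<lambda>y. exp (- \<i> * y)) a k l x) / 2"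
  unfolding Upsilon_sum_def sum.distrib[symmetric] sum_divide_distrib
  by (intro sum.cong refl) (simp add: cos_exp_eq distrib_left)

lemma Upsilon_sum_sin_eq:
  "Upsilon_sum sin a k l x =
    (Upsilon_sum (\<lambda>y. exp (\<i> * y)) a k l x - Upsilon_sum (\<lambda>y. exp (- \<i> * y)) a k l x) / (2 * \<i>)"
  unfolding Upsilon_sum_def sum_subtractf[symmetric] sum_divide_distrib
  by (intro sum.cong refl) (simp add: sin_exp_eq right_diff_distrib)

text \<open>
  By Euler's formula \<open>1 - \<epsilon> tan x = exp (- \<epsilon> x) / cos x\<close>, and for \<open>\<bar>x\<bar> < pi / 2\<close> the principal logarithm of
  this number is \<open>- \<epsilon> x - ln (cos x)\<close>. So the right-hand side is \<open>(1 - \<epsilon> tan x)\<^sup>-\<^sup>c\<close>.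
\<close>

lemma exp_angle_tan_series:
  fixes x :: real and c \<epsilon> :: complex
  assumes \<epsilon>: "\<epsilon> \<in> {\<i>, - \<i>}" and x: "\<bar>x\<bar> < pi / 2" and t: "\<bar>tan x\<bar> < 1"
  shows "(\<lambda>j. pochhammer c j / fact j * (\<epsilon> * of_real (tan x)) ^ j)
           sums (exp (\<epsilon> * (c * of_real x)) * exp (c * of_real (ln (cos x))))"
proof -
  have cos: "cos x > 0"
    using x by (intro cos_gt_zero_pi) auto
  define w where "w = - (\<epsilon> * of_real x) - of_real (ln (cos x))"
  have "exp w = exp (- (\<epsilon> * of_real x)) / of_real (cos x)"
    using cos by (simp add: w_def exp_diff exp_of_real)
  also have "exp (- (\<epsilon> * of_real x)) = of_real (cos x) - \<epsilon> * of_real (sin x)"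
  proof -
    have "exp (- (\<i> * of_real x)) = of_real (cos x) - \<i> * of_real (sin x)"
      using exp_Euler[of "- of_real x"] by (simp add: cos_of_real sin_of_real)
    moreover have "exp (\<i> * of_real x) = of_real (cos x) + \<i> * of_real (sin x)"
      using exp_Euler[of "of_real x"] by (simp add: cos_of_real sin_of_real)
    ultimately show ?thesis using \<epsilon> by auto
  qed
  also have "\<dots> / of_real (cos x) = 1 - \<epsilon> * of_real (tan x)"
    using cos by (simp add: tan_def diff_divide_distrib)
  finally have exp_w: "exp w = 1 - \<epsilon> * of_real (tan x)" .
  have "ln (exp w) = w"
    using \<epsilon> x by (intro Ln_exp) (auto simp: w_def)
  then have "(1 - \<epsilon> * of_real (tan x)) powr (- c) = exp (- c * w)"
    unfolding exp_w[symmetric] powr_def by simp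
  also have "\<dots> = exp (\<epsilon> * (c * of_real x)) * exp (c * of_real (ln (cos x)))"
    unfolding w_def exp_add[symmetric] by (simp add: algebra_simps)
  finally show ?thesis
    using binomial_series_pochhammer[of "\<epsilon> * of_real (tan x)" c] \<epsilon> t by (auto simp: norm_mult)
qed

text \<open>
  The term with indices \<open>p, q\<close> contributes a binomial series shifted by \<open>p\<close>. The identities
  \<open>(a)\<^sub>p\<^sub>+\<^sub>q (a + p + q)\<^sub>j = (a)\<^sub>m (a + m)\<^sub>q\<close> and \<open>(-1)\<^sup>p m! / j! = (-m)\<^sub>p\<close> for \<open>m = p + j\<close> turn its \<open>m\<close>-th
  coefficient into a product of a function of \<open>p\<close> and a function of \<open>q\<close>, each summed by
  \<open>sum_bessel_coeff_pochhammer\<close>. The factor \<open>(-m)\<^sub>p\<close> vanishes for \<open>m < p\<close>, which accounts for the shift.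
\<close>

lemma Upsilon_sum_exp_tan_series:
  fixes x :: real and a \<epsilon> :: complex
  assumes \<epsilon>: "\<epsilon> \<in> {\<i>, - \<i>}" and x: "\<bar>x\<bar> < pi / 2" and t: "\<bar>tan x\<bar> < 1"
  shows "(\<lambda>m. pochhammer ((1 - of_nat m) / 2) k / pochhammer (1 / 2) k
             * (pochhammer ((a + of_nat m + 1) / 2) l / pochhammer (1 / 2) l)
             * (pochhammer a m / fact m) * (\<epsilon> * of_real (tan x)) ^ m)
         sums (exp (a * of_real (ln (cos x))) * Upsilon_sum (\<lambda>y. exp (\<epsilon> * y)) a k l (of_real x))"
proof -
  have cos: "cos x > 0"
    using x by (intro cos_gt_zero_pi) auto
  define L where "L = complex_of_real (ln (cos x))"
  have exp_L: "exp L = of_real (cos x)"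
    using cos by (simp add: L_def exp_of_real)
  define T where "T = complex_of_real (tan x)"
  have sin_eq: "of_real (sin x) = T * exp L"
    using cos by (simp add: T_def exp_L tan_def)
  \<comment> \<open>The phase shift by \<open>p\<close> quarter turns becomes the factor \<open>(-\<epsilon>)\<^sup>p\<close>.\<close>
  have exp_quarter: "exp (- (\<epsilon> * (of_real pi / 2))) = - \<epsilon>"
  proof -
    have euler: "exp (\<i> * of_real y) = of_real (cos y) + \<i> * of_real (sin y)" for y
      by (simp add: exp_Euler cos_of_real sin_of_real)
    have "exp (- (\<i> * (of_real pi / 2))) = - \<i>" "exp (\<i> * (of_real pi / 2)) = \<i>"
      using euler[of "- (pi / 2)"] euler[of "pi / 2"] by simp_all
    then show ?thesis using \<epsilon> by auto
  qed
  \<comment> \<open>The share of the indices \<open>p, q\<close> in the term of order \<open>m\<close>.\<close>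
  define h where "h p q m = bessel_coeff k p * bessel_coeff l q * pochhammer (- of_nat m) p
     * pochhammer (a + of_nat m) q * (pochhammer a m / fact m * (\<epsilon> * T) ^ m)" for p q m
  have "h p q sums (exp (a * L) * (Upsilon a k l p q (of_real x)
      * exp (\<epsilon> * (a * of_real x + of_nat (p + q) * of_real x - of_real pi / 2 * of_nat p))))" for p q
  proof -
    define c where "c = a + of_nat (p + q)"
    define K where "K = bessel_coeff k p * bessel_coeff l q * pochhammer a (p + q) * (- \<epsilon> * T) ^ p"
    have "exp (\<epsilon> * (a * of_real x + of_nat (p + q) * of_real x - of_real pi / 2 * of_nat p))
        = exp (\<epsilon> * (c * of_real x)) * (- \<epsilon>) ^ p"
      unfolding exp_quarter[symmetric] c_def exp_of_nat_mult[symmetric] exp_add[symmetric]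
      by (simp add: algebra_simps)
    moreover have "exp (a * L) * (T * exp L) ^ p * exp L ^ q = T ^ p * exp (c * L)"
      unfolding c_def power_mult_distrib exp_of_nat_mult[symmetric]
      by (simp add: algebra_simps exp_add)
    then have "exp (a * L) * Upsilon a k l p q (of_real x) = bessel_coeff k p * bessel_coeff l q * pochhammer a (p + q) * (T ^ p * exp (c * L))"
      unfolding Upsilon_eq_bessel_coeff sin_of_real cos_of_real sin_eq exp_L[symmetric]
      by (simp add: mult_ac)
    ultimately have "exp (a * L) * (Upsilon a k l p q (of_real x)
      * exp (\<epsilon> * (a * of_real x + of_nat (p + q) * of_real x - of_real pi / 2 * of_nat p)))
       = K * (exp (\<epsilon> * (c * of_real x)) * exp (c * L))"
      unfolding K_def power_mult_distrib by (simp add: mult_ac)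
    moreover have "(\<lambda>j. K * (pochhammer c j / fact j * (\<epsilon> * T) ^ j)) sums (K * (exp (\<epsilon> * (c * of_real x)) * exp (c * L)))"
      unfolding T_def L_def by (intro sums_mult exp_angle_tan_series assms)
    moreover have "K * (pochhammer c j / fact j * (\<epsilon> * T) ^ j) = h p q (j + p)" for j
    proof -
      have "pochhammer a (p + q) * pochhammer c j = pochhammer a (j + p + q)"
        using pochhammer_product'[of a "p + q" j] by (simp add: c_def add_ac)
      also have "\<dots> = pochhammer a (j + p) * pochhammer (a + of_nat (j + p)) q"
        by (rule pochhammer_product')
      finally have 1: "pochhammer a (p + q) * pochhammer c j = pochhammer a (j + p) * pochhammer (a + of_nat (j + p)) q" .
      have 2: "pochhammer (- of_nat (j + p)) p = ((- 1) ^ p * fact (j + p) / fact j :: complex)"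
        using pochhammer_minus_of_nat_add[of p j] by (simp only: add.commute)
      have "K * (pochhammer c j / fact j * (\<epsilon> * T) ^ j) = bessel_coeff k p * bessel_coeff l q
          * (pochhammer a (p + q) * pochhammer c j) * ((- 1) ^ p / fact j) * (\<epsilon> * T) ^ (j + p)"
        unfolding K_def power_add power_mult_distrib power_minus[of \<epsilon>] by (simp add: mult_ac)
      also have "\<dots> = h p q (j + p)"
        unfolding 1 h_def 2 by (simp add: mult_ac)
      finally show ?thesis .
    qed
    moreover have "h p q m = 0" if "m < p" for m
      using that by (simp add: h_def pochhammer_of_nat_eq_0_lemma)
    ultimately show ?thesis
      using sums_zero_iff_shift[of p "h p q"] by simp
  qed
  then have "(\<lambda>m. \<Sum>p=0..k. \<Sum>q=0..l. h p q m) sums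
      (exp (a * L) * Upsilon_sum (\<lambda>y. exp (\<epsilon> * y)) a k l (of_real x))"
    unfolding Upsilon_sum_def sum_distrib_left by (intro sums_sum)
  moreover have "(\<Sum>p=0..k. \<Sum>q=0..l. h p q m) = pochhammer ((1 - of_nat m) / 2) k / pochhammer (1 / 2) k
             * (pochhammer ((a + of_nat m + 1) / 2) l / pochhammer (1 / 2) l)
             * (pochhammer a m / fact m) * (\<epsilon> * T) ^ m" for m
  proof -
    have "(\<Sum>p=0..k. \<Sum>q=0..l. h p q m) = (\<Sum>p=0..k. bessel_coeff k p * pochhammer (- of_nat m) p)
        * (\<Sum>q=0..l. bessel_coeff l q * pochhammer (a + of_nat m) q) * (pochhammer a m / fact m * (\<epsilon> * T) ^ m)"
      unfolding sum_product
      unfolding sum_distrib_right h_def by (intro sum.cong refl) (simp only: mult_ac)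
    also have "- of_nat m + 1 = (1 - of_nat m :: complex)" by simp
    then have "(\<Sum>p=0..k. bessel_coeff k p * pochhammer (- of_nat m) p)
        * (\<Sum>q=0..l. bessel_coeff l q * pochhammer (a + of_nat m) q) * (pochhammer a m / fact m * (\<epsilon> * T) ^ m)
      = pochhammer ((1 - of_nat m) / 2) k / pochhammer (1 / 2) k
             * (pochhammer ((a + of_nat m + 1) / 2) l / pochhammer (1 / 2) l)
             * (pochhammer a m / fact m * (\<epsilon> * T) ^ m)"
      unfolding sum_bessel_coeff_pochhammer by (simp only:)
    finally show ?thesis by (simp only: mult.assoc)
  qed
  ultimately show ?thesis by (simp only: T_def L_def)
qed

section \<open>The identities for small real arguments\<close>

lemma sums_even_subsequence:
  fixes f :: "nat \<Rightarrow> complex"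
  assumes "f sums S" "\<And>m. odd m \<Longrightarrow> f m = 0"
  shows "(\<lambda>r. f (2 * r)) sums S"
  using assms by (subst sums_mono_reindex) (auto simp: strict_mono_def elim!: evenE)

lemma sums_odd_subsequence:
  fixes f :: "nat \<Rightarrow> complex"
  assumes "f sums S" "\<And>m. even m \<Longrightarrow> f m = 0" "\<And>j. j < k \<Longrightarrow> f (2 * j + 1) = 0"
  shows "(\<lambda>r. f (2 * (k + r) + 1)) sums S"
proof (subst sums_mono_reindex)
  fix m
  assume m: "m \<notin> range (\<lambda>r. 2 * (k + r) + 1)"
  show "f m = 0"
  proof (cases "even m")
    case False
    then obtain j where j: "m = 2 * j + 1" by (elim oddE)
    have "j < k"
    proof (rule ccontr)
      assume "\<not> j < k"
      then have "m = 2 * (k + (j - k)) + 1" using j by simp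
      then show False using m by blast
    qed
    then show ?thesis using assms(3) j by simp
  qed (use assms(2) in simp)
qed (use assms(1) in \<open>auto simp: strict_mono_def\<close>)

text \<open>
  The odd powers cancel between \<open>\<epsilon> = i\<close> and \<open>\<epsilon> = - i\<close>; the terms of even order are those of
  the series \<open>\<^sub>2F\<^sub>1(a/2, (a+1)/2 + l; 1/2 - k; - tan\<^sup>2 x)\<close> up to a constant, to which Pfaff's transformation
  applies.
\<close>

lemma Upsilon_sum_cos_of_real:
  fixes x :: real
  assumes x: "\<bar>x\<bar> < pi / 2" and s: "(sin x)\<^sup>2 < 1 / 2" and t: "\<bar>tan x\<bar> < 1"
  shows "Upsilon_sum cos a k l (of_real x) = pochhammer ((a + 1) / 2) l / pochhammer (1 / 2) l
     * gauss_2F1 (a / 2) (- a / 2 - of_nat k - of_nat l) (1 / 2 - of_nat k) ((of_real (sin x))\<^sup>2)"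
proof -
  define T L where "T = complex_of_real (tan x)" and "L = complex_of_real (ln (cos x))"
  define c where "c m = pochhammer ((1 - of_nat m) / 2) k / pochhammer (1 / 2) k
             * (pochhammer ((a + of_nat m + 1) / 2) l / pochhammer (1 / 2) l)
             * (pochhammer a m / fact m)" for m
  define F where "F = gauss_2F1 (a / 2) ((1 / 2 - of_nat k) - (- a / 2 - of_nat k - of_nat l)) (1 / 2 - of_nat k) (- T\<^sup>2)"
  define P where "P = pochhammer ((a + 1) / 2) l / pochhammer (1 / 2) l"
  have C: "1 / 2 - of_nat k \<noteq> - (of_nat i :: complex)" for i
  proof
    assume "1 / 2 - of_nat k = - (of_nat i :: complex)"
    then have "of_nat (2 * i + 1) = (of_nat (2 * k) :: complex)"
      by (simp add: field_simps)
    then have "2 * i + 1 = 2 * k"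
      by (simp only: of_nat_eq_iff)
    then show False by presburger
  qed
  have series: "(\<lambda>m. c m * (\<epsilon> * T) ^ m) sums
      (exp (a * L) * Upsilon_sum (\<lambda>y. exp (\<epsilon> * y)) a k l (of_real x))" if "\<epsilon> \<in> {\<i>, - \<i>}" for \<epsilon>
    unfolding c_def T_def L_def using that x t by (rule Upsilon_sum_exp_tan_series)
  have "(\<lambda>m. (c m * (\<i> * T) ^ m + c m * (- \<i> * T) ^ m) / 2) sums (exp (a * L) * Upsilon_sum cos a k l (of_real x))"
    unfolding Upsilon_sum_cos_eq distrib_left times_divide_eq_right
    by (intro sums_divide sums_add series) simp_all
  then have "(\<lambda>r. (c (2 * r) * (\<i> * T) ^ (2 * r) + c (2 * r) * (- \<i> * T) ^ (2 * r)) / 2)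
      sums (exp (a * L) * Upsilon_sum cos a k l (of_real x))"
    by (rule sums_even_subsequence) simp
  moreover have "(c (2 * r) * (\<i> * T) ^ (2 * r) + c (2 * r) * (- \<i> * T) ^ (2 * r)) / 2 =
     P * (pochhammer (a / 2) r * pochhammer ((1 / 2 - of_nat k) - (- a / 2 - of_nat k - of_nat l)) r
        / (pochhammer (1 / 2 - of_nat k) r * fact r) * (- T\<^sup>2) ^ r)" for r
  proof -
    have "(c (2 * r) * (\<i> * T) ^ (2 * r) + c (2 * r) * (- \<i> * T) ^ (2 * r)) / 2 = c (2 * r) * (- T\<^sup>2) ^ r"
      by (simp add: power_mult power_mult_distrib)
    moreover have "c (2 * r) = P * (pochhammer (a / 2) r * pochhammer ((1 / 2 - of_nat k) - (- a / 2 - of_nat k - of_nat l)) r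
        / (pochhammer (1 / 2 - of_nat k) r * fact r))"
    proof -
      define X Y S Q V where "X = pochhammer (1 / 2 - of_nat r :: complex) k"
        and "Y = pochhammer (1 / 2 - of_nat k :: complex) r"
        and "S = pochhammer ((a + 1) / 2) r" and "Q = pochhammer ((a + 1) / 2 + of_nat r) l"
        and "V = pochhammer ((a + 1) / 2 + of_nat l) r"
      have args: "(1 - of_nat (2 * r)) / 2 = (1 / 2 - of_nat r :: complex)"
        "(a + of_nat (2 * r) + 1) / 2 = (a + 1) / 2 + of_nat r"
        "1 / 2 - of_nat k - (- a / 2 - of_nat k - of_nat l) = (a + 1) / 2 + of_nat l"
        by (simp_all add: add_divide_distrib diff_divide_distrib)
      have half_nz: "pochhammer (1 / 2 :: complex) n \<noteq> 0" for n
        by (rule pochhammer_half_nonzero)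
      have XY: "X * Y = pochhammer (1 / 2) k * pochhammer (1 / 2) r"
        unfolding X_def Y_def by (rule pochhammer_half_integer_reflection)
      then have Y: "Y \<noteq> 0" using half_nz by auto
      have SQ: "S * Q = pochhammer ((a + 1) / 2) l * V"
        unfolding S_def Q_def V_def pochhammer_product'[symmetric] by (simp only: add.commute)
      have fact_eq: "fact (2 * r) = 4 ^ r * pochhammer (1 / 2) r * (fact r :: complex)"
        using pochhammer_double_halves[of 1 r] by (simp add: pochhammer_fact)
      have "c (2 * r) = X / (pochhammer (1 / 2) k * pochhammer (1 / 2) r)
          * ((S * Q) * pochhammer (a / 2) r / (pochhammer (1 / 2) l * fact r))"
        unfolding c_def args pochhammer_double_halves fact_eq X_def S_def Q_def by (simp add: mult_ac)
      also have "X / (pochhammer (1 / 2) k * pochhammer (1 / 2) r) = 1 / Y"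
        using XY Y half_nz by (simp add: frac_eq_eq)
      finally show ?thesis
        unfolding SQ args P_def Y_def V_def by (simp add: mult_ac)
    qed
    ultimately show ?thesis by (simp only: mult.assoc)
  qed
  ultimately have "(\<lambda>r. P * (pochhammer (a / 2) r * pochhammer ((1 / 2 - of_nat k) - (- a / 2 - of_nat k - of_nat l)) r
        / (pochhammer (1 / 2 - of_nat k) r * fact r) * (- T\<^sup>2) ^ r)) sums (exp (a * L) * Upsilon_sum cos a k l (of_real x))"
    by (simp only:)
  moreover have "norm (- T\<^sup>2) < 1"
    using t by (simp add: T_def norm_power abs_square_less_1)
  then have "(\<lambda>r. P * (pochhammer (a / 2) r * pochhammer ((1 / 2 - of_nat k) - (- a / 2 - of_nat k - of_nat l)) r
        / (pochhammer (1 / 2 - of_nat k) r * fact r) * (- T\<^sup>2) ^ r)) sums (P * F)"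
    unfolding F_def by (intro sums_mult gauss_2F1_sums)
  ultimately have "exp (a * L) * Upsilon_sum cos a k l (of_real x) = P * F"
    by (rule sums_unique2)
  also have "F = exp (a * L) * gauss_2F1 (a / 2) (- a / 2 - of_nat k - of_nat l) (1 / 2 - of_nat k) ((of_real (sin x))\<^sup>2)"
  proof -
    have "2 * (a / 2) = a" by simp
    then show ?thesis
      unfolding F_def T_def L_def
      using gauss_2F1_tan_squared[OF C x s, of "a / 2" "- a / 2 - of_nat k - of_nat l"] by (simp only:)
  qed
  finally have "exp (a * L) * Upsilon_sum cos a k l (of_real x) = exp (a * L) *
      (P * gauss_2F1 (a / 2) (- a / 2 - of_nat k - of_nat l) (1 / 2 - of_nat k) ((of_real (sin x))\<^sup>2))"
    by (simp only: mult.left_commute)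
  then show ?thesis
    unfolding P_def mult_left_cancel[OF exp_not_eq_zero] .
qed

text \<open>
  Here the even powers cancel. For \<open>m = 2 j + 1\<close> the coefficient contains \<open>(-j)\<^sub>k\<close>, which is zero for
  \<open>j < k\<close>; the remaining powers \<open>m = 2 (k + r) + 1\<close> form a constant multiple of
  \<open>\<^sub>2F\<^sub>1((a+1)/2 + k, a/2 + k + l + 1; 3/2 + k; - tan\<^sup>2 x)\<close> times \<open>tan\<^sup>2\<^sup>k\<^sup>+\<^sup>1 x\<close>.
\<close>

lemma Upsilon_sum_sin_of_real:
  fixes x :: real
  assumes x: "\<bar>x\<bar> < pi / 2" and s: "(sin x)\<^sup>2 < 1 / 2" and t: "\<bar>tan x\<bar> < 1"
  shows "Upsilon_sum sin a k l (of_real x) =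
     pochhammer ((a + 1) / 2) k * pochhammer (a / 2) (k + l + 1) * of_real (sin x) ^ (2 * k + 1)
           / (pochhammer (1 / 2) k * pochhammer (1 / 2) (k + 1) * pochhammer (1 / 2) l)
           * gauss_2F1 ((a + 1) / 2 + of_nat k) ((1 - a) / 2 - of_nat l) (3 / 2 + of_nat k)
               ((of_real (sin x))\<^sup>2)"
proof -
  have cos: "cos x > 0"
    using x by (intro cos_gt_zero_pi) auto
  define T L where "T = complex_of_real (tan x)" and "L = complex_of_real (ln (cos x))"
  define c where "c m = pochhammer ((1 - of_nat m) / 2) k / pochhammer (1 / 2) k
             * (pochhammer ((a + of_nat m + 1) / 2) l / pochhammer (1 / 2) l)
             * (pochhammer a m / fact m)" for m
  define A B C where "A = (a + 1) / 2 + of_nat k" and "B = (1 - a) / 2 - of_nat l" and "C = (3 / 2 + of_nat k :: complex)"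
  define P where "P = pochhammer ((a + 1) / 2) k * pochhammer (a / 2) (k + l + 1)
           / (pochhammer (1 / 2) k * pochhammer (1 / 2) (k + 1) * pochhammer (1 / 2) l)"
  have C: "C \<noteq> - (of_nat i :: complex)" for i
  proof
    assume "C = - of_nat i"
    then have "Re C = Re (- of_nat i)" by (rule arg_cong)
    then show False by (simp add: C_def)
  qed
  have series: "(\<lambda>m. c m * (\<epsilon> * T) ^ m) sums
      (exp (a * L) * Upsilon_sum (\<lambda>y. exp (\<epsilon> * y)) a k l (of_real x))" if "\<epsilon> \<in> {\<i>, - \<i>}" for \<epsilon>
    unfolding c_def T_def L_def using that x t by (rule Upsilon_sum_exp_tan_series)
  have "(\<lambda>m. (c m * (\<i> * T) ^ m - c m * (- \<i> * T) ^ m) / (2 * \<i>)) sums (exp (a * L) * Upsilon_sum sin a k l (of_real x))"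
    unfolding Upsilon_sum_sin_eq right_diff_distrib times_divide_eq_right
    by (intro sums_divide sums_diff series) simp_all
  then have "(\<lambda>r. (c (2 * (k + r) + 1) * (\<i> * T) ^ (2 * (k + r) + 1) - c (2 * (k + r) + 1) * (- \<i> * T) ^ (2 * (k + r) + 1)) / (2 * \<i>))
      sums (exp (a * L) * Upsilon_sum sin a k l (of_real x))"
  proof (rule sums_odd_subsequence)
    show "(c (2 * j + 1) * (\<i> * T) ^ (2 * j + 1) - c (2 * j + 1) * (- \<i> * T) ^ (2 * j + 1)) / (2 * \<i>) = 0" if "j < k" for j
    proof -
      have "(1 - of_nat (2 * j + 1)) / 2 = (- of_nat j :: complex)" by simp
      then have "c (2 * j + 1) = 0"
        unfolding c_def using pochhammer_of_nat_eq_0_lemma[OF that, where ?'a = complex] by (simp only:) simp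
      then show ?thesis by simp
    qed
  qed simp
  moreover have "(c (2 * (k + r) + 1) * (\<i> * T) ^ (2 * (k + r) + 1) - c (2 * (k + r) + 1) * (- \<i> * T) ^ (2 * (k + r) + 1)) / (2 * \<i>) =
     P * T ^ (2 * k + 1) * (pochhammer A r * pochhammer (C - B) r / (pochhammer C r * fact r) * (- T\<^sup>2) ^ r)" for r
  proof -
    have coeff_pair: "(c (2 * (k + r) + 1) * (\<i> * T) ^ (2 * (k + r) + 1) - c (2 * (k + r) + 1) * (- \<i> * T) ^ (2 * (k + r) + 1)) / (2 * \<i>)
       = c (2 * (k + r) + 1) * (- 1) ^ k * T ^ (2 * k + 1) * (- T\<^sup>2) ^ r"
    proof -
      have pow: "(\<epsilon> * T) ^ (2 * (k + r) + 1) = \<epsilon> * ((- 1) ^ k * T ^ (2 * k + 1) * (- T\<^sup>2) ^ r)"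
        if "\<epsilon>\<^sup>2 = - 1" for \<epsilon>
      proof -
        have "(\<epsilon> * T) ^ (2 * (k + r) + 1) = (\<epsilon> * T) * ((\<epsilon> * T)\<^sup>2) ^ (k + r)"
          unfolding power_mult[symmetric] by simp
        also have "(\<epsilon> * T)\<^sup>2 = - T\<^sup>2"
          by (simp add: power_mult_distrib that)
        also have "(- T\<^sup>2) ^ (k + r) = (- 1) ^ k * T ^ (2 * k) * (- T\<^sup>2) ^ r"
          by (simp only: power_add power_minus[of "T\<^sup>2" k] power_mult)
        finally show ?thesis
          by (simp only: power_add power_one_right mult_ac)
      qed
      have "(\<i> * T) ^ (2 * (k + r) + 1) = \<i> * ((- 1) ^ k * T ^ (2 * k + 1) * (- T\<^sup>2) ^ r)"
        "(- \<i> * T) ^ (2 * (k + r) + 1) = - \<i> * ((- 1) ^ k * T ^ (2 * k + 1) * (- T\<^sup>2) ^ r)"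
        by (rule pow, simp)+
      then show ?thesis by (simp only:) simp
    qed
    have coeff: "c (2 * (k + r) + 1) * (- 1) ^ k = P * (pochhammer A r * pochhammer (C - B) r / (pochhammer C r * fact r))"
    proof -
      define n where "n = k + r"
      define S U Q V W where "S = pochhammer ((a + 1) / 2) n" and "U = pochhammer (a / 2) (n + 1)"
        and "Q = pochhammer (a / 2 + of_nat (n + 1)) l" and "V = pochhammer (C - B) r"
        and "W = pochhammer (1 / 2 :: complex) (n + 1)"
      have args: "(1 - of_nat (2 * n + 1)) / 2 = - (of_nat n :: complex)"
        "(a + of_nat (2 * n + 1) + 1) / 2 = a / 2 + of_nat (n + 1)"
        by (simp_all add: add_divide_distrib diff_divide_distrib)
      have CB: "C - B = a / 2 + of_nat (k + l + 1)" and C': "C = 1 / 2 + of_nat (k + 1)"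
        by (simp_all add: C_def B_def diff_divide_distrib)
      have S: "S = pochhammer ((a + 1) / 2) k * pochhammer A r"
        unfolding S_def n_def A_def by (rule pochhammer_product')
      have W: "W = pochhammer (1 / 2) (k + 1) * pochhammer C r"
        unfolding W_def n_def C' pochhammer_product'[symmetric] by (simp only: add_ac)
      have UQ: "U * Q = pochhammer (a / 2) (k + l + 1) * V"
        unfolding U_def Q_def V_def n_def CB pochhammer_product'[symmetric] by (simp only: add_ac)
      have fact_eq: "fact (2 * n + 1) = 2 * 4 ^ n * fact n * W"
        using pochhammer_double_Suc[of 1 n] unfolding W_def pochhammer_fact by simp
      have falling: "pochhammer (- of_nat n) k = ((- 1) ^ k * fact n / fact r :: complex)"
        unfolding n_def by (rule pochhammer_minus_of_nat_add)
      have "c (2 * n + 1) * (- 1) ^ k = S * (U * Q) / (pochhammer (1 / 2) k * W * pochhammer (1 / 2) l * fact r)"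
        unfolding c_def args pochhammer_double_Suc fact_eq falling S_def[symmetric] U_def[symmetric] Q_def[symmetric]
        by (simp add: mult_ac)
      then show ?thesis
        unfolding S W UQ P_def V_def n_def by (simp add: mult_ac)
    qed
    show ?thesis unfolding coeff_pair coeff by (simp only: mult_ac)
  qed
  ultimately have "(\<lambda>r. P * T ^ (2 * k + 1) * (pochhammer A r * pochhammer (C - B) r / (pochhammer C r * fact r) * (- T\<^sup>2) ^ r))
      sums (exp (a * L) * Upsilon_sum sin a k l (of_real x))"
    by (simp only:)
  moreover have "norm (- T\<^sup>2) < 1"
    using t by (simp add: T_def norm_power abs_square_less_1)
  then have "(\<lambda>r. P * T ^ (2 * k + 1) * (pochhammer A r * pochhammer (C - B) r / (pochhammer C r * fact r) * (- T\<^sup>2) ^ r))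
      sums (P * T ^ (2 * k + 1) * gauss_2F1 A (C - B) C (- T\<^sup>2))"
    by (intro sums_mult gauss_2F1_sums)
  ultimately have expansion: "exp (a * L) * Upsilon_sum sin a k l (of_real x) = P * T ^ (2 * k + 1) * gauss_2F1 A (C - B) C (- T\<^sup>2)"
    by (rule sums_unique2)
  have pfaff: "gauss_2F1 A (C - B) C (- T\<^sup>2) = exp (2 * A * L) * gauss_2F1 A B C ((of_real (sin x))\<^sup>2)"
    unfolding T_def L_def by (rule gauss_2F1_tan_squared[OF C x s])
  have sin_power: "T ^ (2 * k + 1) * exp (2 * A * L) = exp (a * L) * of_real (sin x) ^ (2 * k + 1)"
  proof -
    have "exp L = of_real (cos x)"
      using cos by (simp add: L_def exp_of_real)
    then have "of_real (sin x) = T * exp L"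
      using cos by (simp add: T_def tan_def)
    moreover have "2 * A * L = a * L + of_nat (2 * k + 1) * L"
      by (simp add: A_def algebra_simps)
    ultimately show ?thesis
      by (simp only: power_mult_distrib exp_add exp_of_nat_mult) (simp only: mult_ac)
  qed
  have "exp (a * L) * Upsilon_sum sin a k l (of_real x)
      = P * (T ^ (2 * k + 1) * exp (2 * A * L)) * gauss_2F1 A B C ((of_real (sin x))\<^sup>2)"
    unfolding expansion pfaff by (simp only: mult.assoc)
  also have "\<dots> = exp (a * L) * (P * of_real (sin x) ^ (2 * k + 1) * gauss_2F1 A B C ((of_real (sin x))\<^sup>2))"
    unfolding sin_power by (simp only: mult_ac)
  finally have "exp (a * L) * Upsilon_sum sin a k l (of_real x)
      = exp (a * L) * (P * of_real (sin x) ^ (2 * k + 1) * gauss_2F1 A B C ((of_real (sin x))\<^sup>2))" .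
  then show ?thesis
    unfolding mult_left_cancel[OF exp_not_eq_zero] P_def A_def B_def C_def by (simp only: times_divide_eq_left)
qed

section \<open>Analytic continuation in the sine\<close>

lemma holomorphic_on_Upsilon_sum_Arcsin:
  assumes "f holomorphic_on UNIV"
  shows "(\<lambda>t. Upsilon_sum f a k l (Arcsin t)) holomorphic_on ball 0 1"
proof -
  have Arcsin: "Arcsin holomorphic_on ball 0 1"
    by (intro holomorphic_on_Arcsin) (auto intro: le_less_trans[OF abs_Re_le_cmod])
  have comp: "(\<lambda>t. f (g t)) holomorphic_on ball 0 1" if "g holomorphic_on ball 0 1" for g
    using holomorphic_on_compose_gen[OF that assms] by (simp add: o_def)
  show ?thesis
    unfolding Upsilon_sum_def Upsilon_eq_bessel_coeff
    by (intro holomorphic_intros comp Arcsin)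
qed

text \<open>
  In the variable \<open>t = sin x\<close> the region \<open>\<bar>Re x\<bar> < pi / 2\<close>, \<open>norm (sin x) < 1\<close> becomes the unit disc, with
  inverse \<open>Arcsin\<close>; in particular it is connected. The identity theorem is applied on the disc with the
  real segment from 0 to 1/2: there \<open>sin\<^sup>2 x < 1 / 4\<close>, hence \<open>tan\<^sup>2 x < 1 / 3\<close>.
\<close>

lemma eq_Upsilon_sum_of_real_eq:
  assumes f: "f holomorphic_on UNIV" and G: "G holomorphic_on ball 0 1"
    and eq: "\<And>x :: real. \<bar>x\<bar> < pi / 2 \<Longrightarrow> (sin x)\<^sup>2 < 1 / 2 \<Longrightarrow> \<bar>tan x\<bar> < 1 \<Longrightarrow>
           Upsilon_sum f a k l (of_real x) = G (of_real (sin x))"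
    and x: "\<bar>Re x\<bar> < pi / 2" "norm (sin x) < 1"
  shows "G (sin x) = Upsilon_sum f a k l x"
proof -
  let ?h = "\<lambda>t. G t - Upsilon_sum f a k l (Arcsin t)"
  let ?U = "complex_of_real ` {0<..<1 / 2}"
  have hol: "?h holomorphic_on ball 0 1"
    by (intro holomorphic_intros G holomorphic_on_Upsilon_sum_Arcsin f)
  have sub: "?U \<subseteq> ball 0 1"
    by auto
  have lim: "0 islimpt ?U"
    unfolding islimpt_approachable
  proof (intro allI impI)
    fix e :: real
    assume "e > 0"
    then show "\<exists>t\<in>?U. t \<noteq> 0 \<and> dist t 0 < e"
      by (intro bexI[of _ "of_real (min (e / 2) (1 / 4))"]) auto
  qed
  have zero: "?h t = 0" if "t \<in> ?U" for t
  proof -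
    from that obtain r where t: "t = of_real r" and r: "0 < r" "r < 1 / 2"
      by auto
    define y where "y = arcsin r"
    have sin: "sin y = r"
      unfolding y_def using r by (intro sin_arcsin) auto
    have y: "\<bar>y\<bar> < pi / 2"
      unfolding y_def using r arcsin_lt_bounded[of r] by auto
    have r2: "r\<^sup>2 < 1 / 4"
      using power_strict_mono[of r "1 / 2" 2] r by (simp add: power_divide)
    have cos: "cos y > 0"
      using y by (intro cos_gt_zero_pi) auto
    have "(tan y)\<^sup>2 < 1"
      unfolding tan_def power_divide cos_squared_eq sin using r2 by (simp add: field_simps)
    then have "\<bar>tan y\<bar> < 1"
      by (simp add: abs_square_less_1)
    then have "Upsilon_sum f a k l (of_real y) = G (of_real r)"
      using eq[of y] y r2 unfolding sin by simp
    moreover have "Arcsin t = of_real y"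
      unfolding t y_def using r by (intro of_real_arcsin[symmetric]) auto
    ultimately show ?thesis by (simp add: t)
  qed
  have "?h (sin x) = 0"
    by (rule analytic_continuation[OF hol open_ball connected_ball sub _ lim zero]) (use x in auto)
  then show ?thesis
    using x(1) by (simp add: Arcsin_sin)
qed

theorem theorem6p1:
  fixes k l :: nat and a x :: complex
  assumes "a \<notin> \<int>"
    and "\<bar>Re x\<bar> < pi / 2" and "norm (sin x) < 1"
  shows "(pochhammer ((a + 1) / 2) l / pochhammer (1 / 2) l
           * gauss_2F1 (a / 2) (- a / 2 - of_nat k - of_nat l) (1 / 2 - of_nat k) ((sin x)\<^sup>2)
         = (\<Sum>p=0..k. \<Sum>q=0..l. Upsilon a k l p q x
              * cos (a * x + of_nat (p + q) * x - of_real pi / 2 * of_nat p)))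
    \<and> (pochhammer ((a + 1) / 2) k * pochhammer (a / 2) (k + l + 1) * sin x ^ (2 * k + 1)
           / (pochhammer (1 / 2) k * pochhammer (1 / 2) (k + 1) * pochhammer (1 / 2) l)
           * gauss_2F1 ((a + 1) / 2 + of_nat k) ((1 - a) / 2 - of_nat l) (3 / 2 + of_nat k)
               ((sin x)\<^sup>2)
         = (\<Sum>p=0..k. \<Sum>q=0..l. Upsilon a k l p q x
              * sin (a * x + of_nat (p + q) * x - of_real pi / 2 * of_nat p)))"
proof
  let ?G = "\<lambda>t. pochhammer ((a + 1) / 2) l / pochhammer (1 / 2) l
           * gauss_2F1 (a / 2) (- a / 2 - of_nat k - of_nat l) (1 / 2 - of_nat k) (t\<^sup>2)"
  have "?G (sin x) = Upsilon_sum cos a k l x"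
    using assms(2,3)
    by (intro eq_Upsilon_sum_of_real_eq Upsilon_sum_cos_of_real holomorphic_intros holomorphic_on_gauss_2F1_squared)
  then show "?G (sin x) = (\<Sum>p=0..k. \<Sum>q=0..l. Upsilon a k l p q x
              * cos (a * x + of_nat (p + q) * x - of_real pi / 2 * of_nat p))"
    unfolding Upsilon_sum_def .
next
  let ?G = "\<lambda>t. pochhammer ((a + 1) / 2) k * pochhammer (a / 2) (k + l + 1) * t ^ (2 * k + 1)
           / (pochhammer (1 / 2) k * pochhammer (1 / 2) (k + 1) * pochhammer (1 / 2) l)
           * gauss_2F1 ((a + 1) / 2 + of_nat k) ((1 - a) / 2 - of_nat l) (3 / 2 + of_nat k) (t\<^sup>2)"
  have "?G (sin x) = Upsilon_sum sin a k l x"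
    using assms(2,3)
    by (intro eq_Upsilon_sum_of_real_eq Upsilon_sum_sin_of_real holomorphic_intros holomorphic_on_gauss_2F1_squared)
       (simp_all add: pochhammer_half_nonzero)
  then show "?G (sin x) = (\<Sum>p=0..k. \<Sum>q=0..l. Upsilon a k l p q x
              * sin (a * x + of_nat (p + q) * x - of_real pi / 2 * of_nat p))"
    unfolding Upsilon_sum_def .
qed

end
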